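(* Consider the system $x(k+1)=A(k)x(k)+B(k)u(k)$, $x(0)=x_0\in\mathbb{R}^n$, composed of $N$ subsystems with the random matrices $A(k)$ satisfying the independence assumptions in the context. Fix $T>0$, let $Q(k)\in\mathcal{S}_+^n$ for $0\le k\le T$ and $R(k)=\mathrm{diag}(R_{11}(k),\dots,R_{NN}(k))\in\mathcal{S}_{++}^m$ for $0\le k\le T-1$ with $R_{ii}(k)\in\mathbb{R}^{m_i\times m_i}$, and let $$J_T(x_0,\{u(k)\}_{k=0}^{T-1})=\mathbb{E}\Big\{x(T)^\top Q(T)x(T)+\sum_{k=0}^{T-1}\Big(x(k)^\top Q(k)x(k)+\sum_{j=1}^N u_j(k)^\top R_{jj}(k)u_j(k)\Big)\Big\}.$$ Then the solution of the problem of minimizing $J_T$ over all control laws with full model information (defined in the context) is given by $$u(k)=-(R(k)+B(k)^\top P(k+1)B(k))^{-1}B(k)^\top P(k+1)A(k)x(k),$$ where $\{P(k)\}_{k=0}^T$ is given by the backward difference equation $$P(k)=Q(k)+\mathbf{R}(\bar A(k),P(k+1),B(k),R(k))+\sum_{i=1}^N\mathbb{E}\{\mathbf{R}(\tilde A_i(k),P(k+1),B(k),R(k))\}$$ with boundary condition $P(T)=Q(T)$. Furthermore, $\inf_{\{u(k)\}_{k=0}^{T-1}}J_T(x_0,\{u(k)\}_{k=0}^{T-1})=x_0^\top P(0)x_0$, the infimum being over control laws with full model information.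
   Context: Notation: $\mathcal{S}_{+}^n$ ($\mathcal{S}_{++}^n$) is the set of symmetric positive semidefinite (positive definite) matrices in $\mathbb{R}^{n\times n}$. The discrete Riccati operator is $\mathbf{R}(A,P,B,R)=A^\top(P-PB(R+B^\top PB)^{-1}B^\top P)A$ for $A\in\mathbb{R}^{n\times n}$, $P\in\mathcal{S}_+^n$, $B\in\mathbb{R}^{n\times m}$, $R\in\mathcal{S}_{++}^m$ (for any positive integers $n,m$). System: there are $N$ subsystems, subsystem $i$ having state $x_i(k)\in\mathbb{R}^{n_i}$, input $u_i(k)\in\mathbb{R}^{m_i}$ and dynamics $x_i(k+1)=\sum_{j=1}^N A_{ij}(k)x_j(k)+B_{ii}(k)u_i(k)$. Put $n=\sum_i n_i$, $m=\sum_i m_i$, $x(k)=[x_1(k)^\top\cdots x_N(k)^\top]^\top$, $u(k)=[u_1(k)^\top\cdots u_N(k)^\top]^\top$; then $x(k+1)=A(k)x(k)+B(k)u(k)$, with $A(k)=[A_{ij}(k)]_{i,j}$ and $B(k)=\mathrm{diag}(B_{11}(k),\dots,B_{NN}(k))$. The matrices $B_{ii}(k)$ and the initial state $x_0$ are deterministic; the $A_{ij}(k)\in\mathbb{R}^{n_i\times n_j}$ are random with finite first and second moments. Independence assumptions: the block rows $[A_{i1}(k)\;\cdots\;A_{iN}(k)]$, $1\le i\le N$, $k\ge0$, are mutually independent, both in time $k$ and across subsystems $i$ (blocks within the same block row at the same time may be dependent). Write $\bar A(k)=\mathbb{E}\{A(k)\}$, $\tilde A_{ij}(k)=A_{ij}(k)-\mathbb{E}\{A_{ij}(k)\}$.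 $\tilde A_i(k)\in\mathbb{R}^{n\times n}$ has $i$-th block row $[\tilde A_{i1}(k)\;\cdots\;\tilde A_{iN}(k)]$ and all other block rows zero. Control laws with full model information: the design of each controller may use the exact realization of the whole matrix $A(k)$ together with the first- and second-order moments $\mathbb{E}\{A(k)\}$, $\mathbb{E}\{\tilde A(k)\otimes\tilde A(k)\}$ for all $k$ (where $\tilde A(k)=A(k)-\bar A(k)$), and the controller measures the full state. That is, at each time $k$, $u_i(k)=\psi_i(A(k);x(0),\dots,x(k))$ for $1\le i\le N$, where $\psi_i$ (possibly depending on $k$) is an arbitrary measurable mapping into $\mathbb{R}^{m_i}$, not necessarily linear. *)

theory Defs
  imports "HOL-Probability.Probability"
begin

definition sym_psd :: "real^'n^'n \<Rightarrow> bool" where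
  "sym_psd M \<longleftrightarrow> transpose M = M \<and> (\<forall>x. 0 \<le> x \<bullet> (M *v x))"

definition sym_pd :: "real^'n^'n \<Rightarrow> bool" where
  "sym_pd M \<longleftrightarrow> transpose M = M \<and> (\<forall>x. x \<noteq> 0 \<longrightarrow> 0 < x \<bullet> (M *v x))"

definition riccati :: "real^'n^'n \<Rightarrow> real^'n^'n \<Rightarrow> real^'m^'n \<Rightarrow> real^'m^'m \<Rightarrow> real^'n^'n" where
  "riccati A P B R =
     transpose A **
       (P - P ** B ** matrix_inv (R + transpose B ** P ** B) ** transpose B ** P) ** A"

text \<open>
  The subsystems are the elements of a finite type \<open>'s\<close>. The coordinates of the overall
  state (input) form a finite type \<open>'n\<close> (\<open>'m\<close>), and a map \<open>'n \<Rightarrow> 's\<close> (\<open>'m \<Rightarrow> 's\<close>) assigns to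
  every coordinate the subsystem it belongs to. So \<open>n\<^sub>i\<close> is the size of the fibre over \<open>i\<close>,
  and the block \<open>(i, j)\<close> of a matrix consists of the entries whose row index lies over \<open>i\<close> and
  whose column index lies over \<open>j\<close>. Block rows and subvectors are padded with zeros, so that
  blocks of different sizes live in one type.
\<close>

definition block_row :: "('n \<Rightarrow> 's) \<Rightarrow> 's \<Rightarrow> real^'k^'n \<Rightarrow> real^'k^'n" where
  "block_row blk i M = (\<chi> a b. if blk a = i then M $ a $ b else 0)"

definition block_vec :: "('m \<Rightarrow> 's) \<Rightarrow> 's \<Rightarrow> real^'m \<Rightarrow> real^'m" where
  "block_vec blk i v = (\<chi> a. if blk a = i then v $ a else 0)"

definition block_diagonal :: "('n \<Rightarrow> 's) \<Rightarrow> ('k \<Rightarrow> 's) \<Rightarrow> real^'k^'n \<Rightarrow> bool" where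
  "block_diagonal rblk cblk M \<longleftrightarrow> (\<forall>a b. rblk a \<noteq> cblk b \<longrightarrow> M $ a $ b = 0)"

text \<open>
  A control law \<open>\<psi>\<close> maps the time \<open>k\<close>, the subsystem \<open>i\<close> and the pair of \<open>A(k)\<close> and the state
  history \<open>x(0), \<dots>, x(k)\<close> to the input \<open>u\<^sub>i(k)\<close>. The history is a function on \<open>{..k}\<close>, extended
  by \<^term>\<open>undefined\<close> as in the product measure space.
\<close>

type_synonym ('n, 'm, 's) control_law =
  "nat \<Rightarrow> 's \<Rightarrow> (real^'n^'n) \<times> (nat \<Rightarrow> real^'n) \<Rightarrow> real^'m"

definition admissible ::
  "('m \<Rightarrow> 's) \<Rightarrow> nat \<Rightarrow> ('n::finite, 'm::finite, 's) control_law \<Rightarrow> bool" where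
  "admissible iblk T \<psi> \<longleftrightarrow>
     (\<forall>k<T. \<forall>i.
        \<psi> k i \<in> borel_measurable (borel \<Otimes>\<^sub>M (\<Pi>\<^sub>M l\<in>{..k}. borel)) \<and>
        (\<forall>h a. iblk a \<noteq> i \<longrightarrow> \<psi> k i h $ a = 0))"

lemma restrict_fundef_cong [fundef_cong]:
  "I = J \<Longrightarrow> (\<And>i. i \<in> J \<Longrightarrow> f i = g i) \<Longrightarrow> restrict f I = restrict g J"
  by (auto simp: restrict_def fun_eq_iff)

text \<open>The closed loop, for one realization \<open>A\<close> of the sequence of random matrices.\<close>

fun state :: "(nat \<Rightarrow> real^'n^'n) \<Rightarrow> (nat \<Rightarrow> real^'m^'n) \<Rightarrow> real^'n \<Rightarrow>
    ('n, 'm, 's::finite) control_law \<Rightarrow> nat \<Rightarrow> real^'n" where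
  "state A B x0 \<psi> 0 = x0"
| "state A B x0 \<psi> (Suc k) =
     A k *v state A B x0 \<psi> k +
     B k *v (\<Sum>i\<in>UNIV. \<psi> k i (A k, \<lambda>l\<in>{..k}. state A B x0 \<psi> l))"

definition sub_input :: "(nat \<Rightarrow> real^'n^'n) \<Rightarrow> (nat \<Rightarrow> real^'m^'n) \<Rightarrow> real^'n \<Rightarrow>
    ('n, 'm, 's::finite) control_law \<Rightarrow> nat \<Rightarrow> 's \<Rightarrow> real^'m" where
  "sub_input A B x0 \<psi> k i = \<psi> k i (A k, \<lambda>l\<in>{..k}. state A B x0 \<psi> l)"

definition input :: "(nat \<Rightarrow> real^'n^'n) \<Rightarrow> (nat \<Rightarrow> real^'m^'n) \<Rightarrow> real^'n \<Rightarrow>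
    ('n, 'm, 's::finite) control_law \<Rightarrow> nat \<Rightarrow> real^'m" where
  "input A B x0 \<psi> k = (\<Sum>i\<in>UNIV. sub_input A B x0 \<psi> k i)"

lemma state_Suc: "state A B x0 \<psi> (Suc k) = A k *v state A B x0 \<psi> k + B k *v input A B x0 \<psi> k"
  by (simp add: input_def sub_input_def)

text \<open>
  The expectation of the cost may be infinite, since control laws are arbitrary measurable maps.
  Because of the zero padding, the summand for subsystem \<open>j\<close> only involves the block \<open>(j, j)\<close>
  of \<open>R k\<close>.
\<close>

definition cost :: "'w measure \<Rightarrow> (nat \<Rightarrow> 'w \<Rightarrow> real^'n^'n) \<Rightarrow> (nat \<Rightarrow> real^'m^'n) \<Rightarrow>
    (nat \<Rightarrow> real^'n^'n) \<Rightarrow> (nat \<Rightarrow> real^'m^'m) \<Rightarrow> nat \<Rightarrow> real^'n \<Rightarrow>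
    ('n, 'm, 's::finite) control_law \<Rightarrow> ennreal" where
  "cost M A B Q R T x0 \<psi> =
     (\<integral>\<^sup>+ \<omega>. ennreal
        (let x = state (\<lambda>k. A k \<omega>) B x0 \<psi>; u = sub_input (\<lambda>k. A k \<omega>) B x0 \<psi>
         in x T \<bullet> (Q T *v x T) +
            (\<Sum>k<T. x k \<bullet> (Q k *v x k) + (\<Sum>j\<in>UNIV. u k j \<bullet> (R k *v u k j)))) \<partial>M)"

definition gain :: "real^'n^'n \<Rightarrow> real^'n^'n \<Rightarrow> real^'m^'n \<Rightarrow> real^'m^'m \<Rightarrow> real^'n^'m" where
  "gain A P B R = - (matrix_inv (R + transpose B ** P ** B) ** transpose B ** P ** A)"

definition riccati_law :: "('m \<Rightarrow> 's) \<Rightarrow> (nat \<Rightarrow> real^'n^'n) \<Rightarrow> (nat \<Rightarrow> real^'m^'n) \<Rightarrow>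
    (nat \<Rightarrow> real^'m^'m) \<Rightarrow> ('n, 'm, 's) control_law" where
  "riccati_law iblk P B R k i = (\<lambda>(A, x). block_vec iblk i (gain A (P (Suc k)) (B k) (R k) *v x k))"

end

theory Submission
  imports Defs
begin

text \<open>
  The argument is dynamic programming with a twist: the controller sees \<open>A(k)\<close> before it chooses
  \<open>u(k)\<close>, so the square is completed for each realization of \<open>A(k)\<close> and the average is taken
  afterwards. Let \<open>Z\<close> be the Schur complement \<open>P - P B (R + B\<^sup>T P B)\<^sup>-\<^sup>1 B\<^sup>T P\<close> formed with
  \<open>P = P(k+1)\<close>. Pointwise,

  \<open>x(k+1)\<^sup>T P x(k+1) + u\<^sup>T R u = x(k)\<^sup>T A(k)\<^sup>T Z A(k) x(k) + (u - K x(k))\<^sup>T (R + B\<^sup>T P B) (u - K x(k))\<close>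

  where \<open>K\<close> is the gain at \<open>A(k)\<close> (\<open>closed_loop_completing_square\<close>). The last term, the excess
  of the control \<open>u\<close>, is nonnegative and vanishes only for \<open>u = K x(k)\<close>.

  Under any admissible law the state \<open>x(k)\<close> is a measurable function of \<open>A(0), \<dots>, A(k-1)\<close>, hence
  independent of \<open>A(k)\<close>, and Tonelli's theorem allows \<open>A(k)\<^sup>T Z A(k)\<close> to be replaced by its mean
  (\<open>nn_integral_state_matrix\<close>, \<open>nn_integral_quadratic_indep\<close>). Independence of the block rows
  makes entries in different block rows uncorrelated, so this mean is the value at the mean of
  \<open>A(k)\<close> plus one covariance term per subsystem (\<open>integral_congruence_block_rows\<close>); thus
  \<open>P(k) = Q(k) + E[A(k)\<^sup>T Z A(k)]\<close>.

  Telescoping over \<open>k\<close> gives, for every admissible law, that the cost equals \<open>x0\<^sup>T P(0) x0\<close> plus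
  the sum of the expected excesses (\<open>cost_eq_value_plus_excess\<close>). All integrands are
  nonnegative, so this is an identity in the extended nonnegative reals and needs no moments of
  the states or inputs. The Riccati law has excess zero, which yields optimality and
  the value of the infimum; a law that attains the same finite cost has excess zero almost surely,
  which yields uniqueness.
\<close>

section \<open>Symmetric matrices and their inverses\<close>

lemma inner_matrix_vector_left:
  fixes A :: "real^'n^'m"
  shows "(A *v x) \<bullet> y = x \<bullet> (transpose A *v y)"
  by (metis dot_lmul_matrix inner_commute transpose_matrix_vector)

lemma inner_sym_matrix_commute:
  fixes P :: "real^'n^'n"
  assumes "transpose P = P"
  shows "x \<bullet> (P *v y) = y \<bullet> (P *v x)"
  by (metis assms inner_commute inner_matrix_vector_left)

lemma transpose_add: "transpose (A + B) = transpose A + transpose (B :: real^'n^'m)"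
  by (simp add: transpose_def vec_eq_iff)

lemma transpose_diff: "transpose (A - B) = transpose A - transpose (B :: real^'n^'m)"
  by (simp add: transpose_def vec_eq_iff)

lemma sym_pd_matrix_inv:
  fixes S :: "real^'m^'m"
  assumes "sym_pd S"
  shows "S ** matrix_inv S = mat 1" "matrix_inv S ** S = mat 1"
    and "transpose (matrix_inv S) = matrix_inv S"
proof -
  have "x = 0" if "S *v x = 0" for x
  proof (rule ccontr)
    assume "x \<noteq> 0"
    then have "0 < x \<bullet> (S *v x)" using assms by (auto simp: sym_pd_def)
    with that show False by simp
  qed
  then have "invertible S"
    by (simp add: invertible_left_inverse matrix_left_invertible_ker)
  then show r: "S ** matrix_inv S = mat 1" and l: "matrix_inv S ** S = mat 1"
    unfolding invertible_def matrix_inv_def by (metis (mono_tags, lifting) someI_ex)+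
  have "transpose (S ** matrix_inv S) = mat 1"
    by (simp add: r)
  then have "transpose (matrix_inv S) ** S = mat 1"
    using assms by (simp add: matrix_transpose_mul sym_pd_def)
  then show "transpose (matrix_inv S) = matrix_inv S"
    by (metis matrix_mul_assoc matrix_mul_lid matrix_mul_rid r)
qed

lemma sym_pd_imp_psd: "sym_pd R \<Longrightarrow> sym_psd R"
  unfolding sym_pd_def sym_psd_def by (metis inner_zero_left less_imp_le order_refl)

lemma sym_pd_input_weight:
  fixes P :: "real^'n^'n" and B :: "real^'m^'n"
  assumes P: "sym_psd P" and R: "sym_pd R"
  shows "sym_pd (R + transpose B ** P ** B)"
  unfolding sym_pd_def
proof (intro conjI allI impI)
  show "transpose (R + transpose B ** P ** B) = R + transpose B ** P ** B"
    using P R by (simp add: transpose_add matrix_transpose_mul sym_psd_def sym_pd_def matrix_mul_assoc)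
  fix u :: "real^'m" assume "u \<noteq> 0"
  then have "0 < u \<bullet> (R *v u)" using R by (simp add: sym_pd_def)
  moreover have "0 \<le> (B *v u) \<bullet> (P *v (B *v u))" using P by (simp add: sym_psd_def)
  ultimately show "0 < u \<bullet> ((R + transpose B ** P ** B) *v u)"
    by (simp add: matrix_vector_mult_add_rdistrib inner_add_right inner_matrix_vector_left
        matrix_vector_mul_assoc matrix_mul_assoc)
qed

section \<open>The Riccati operator and completing the square\<close>

text \<open>
  The Schur complement \<open>Z = P - P B (R + B\<^sup>T P B)\<^sup>-\<^sup>1 B\<^sup>T P\<close>. It does not depend on the system
  matrix, and the Riccati operator is the congruence \<open>A\<^sup>T Z A\<close>; this is what makes the
  operator quadratic in \<open>A\<close>, so that its expectation involves only second moments.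
\<close>
definition riccati_core :: "real^'n^'n \<Rightarrow> real^'m^'n \<Rightarrow> real^'m^'m \<Rightarrow> real^'n^'n" where
  "riccati_core P B R =
     P - P ** B ** matrix_inv (R + transpose B ** P ** B) ** transpose B ** P"

lemma riccati_eq_core: "riccati A P B R = transpose A ** riccati_core P B R ** A"
  by (simp add: riccati_def riccati_core_def)

lemma quadratic_riccati:
  "x \<bullet> (riccati A P B R *v x) = (A *v x) \<bullet> (riccati_core P B R *v (A *v x))"
  by (simp add: riccati_eq_core inner_matrix_vector_left matrix_vector_mul_assoc matrix_mul_assoc)

text \<open>
  Completing the square in \<open>u\<close>: the minimum over \<open>u\<close> of the left-hand side is the quadratic form
  of the Schur complement at \<open>y\<close>.
\<close>
lemma completing_the_square:
  fixes P :: "real^'n^'n" and B :: "real^'m^'n"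
  assumes P: "sym_psd P" and R: "sym_pd R"
  defines "S \<equiv> R + transpose B ** P ** B"
  shows "(y + B *v u) \<bullet> (P *v (y + B *v u)) + u \<bullet> (R *v u) =
    y \<bullet> (riccati_core P B R *v y) +
      (u + matrix_inv S ** transpose B ** P *v y) \<bullet> (S *v (u + matrix_inv S ** transpose B ** P *v y))"
proof -
  note inv = sym_pd_matrix_inv[OF sym_pd_input_weight[OF P R, of B], folded S_def]
  have tP: "transpose P = P" using P by (simp add: sym_psd_def)
  have tS: "transpose S = S" using sym_pd_input_weight[OF P R, of B] by (simp add: S_def sym_pd_def)
  define w where "w = transpose B *v (P *v y)"
  define v where "v = matrix_inv S *v w"
  have Sv: "S *v v = w"
    by (simp add: v_def matrix_vector_mul_assoc inv)
  have v: "matrix_inv S ** transpose B ** P *v y = v"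
    by (simp add: v_def w_def matrix_vector_mul_assoc matrix_mul_assoc)
  have 1: "(B *v u) \<bullet> (P *v y) = u \<bullet> w" "y \<bullet> (P *v (B *v u)) = u \<bullet> w"
    by (simp_all add: inner_matrix_vector_left w_def inner_sym_matrix_commute[OF tP, of y])
  have 2: "u \<bullet> (S *v u) = u \<bullet> (R *v u) + (B *v u) \<bullet> (P *v (B *v u))"
    by (simp add: S_def matrix_vector_mult_add_rdistrib inner_add_right inner_matrix_vector_left
        matrix_vector_mul_assoc matrix_mul_assoc)
  have 3: "y \<bullet> (riccati_core P B R *v y) = y \<bullet> (P *v y) - v \<bullet> w"
  proof -
    have "riccati_core P B R *v y = P *v y - P *v (B *v v)"
      by (simp add: riccati_core_def S_def[symmetric] matrix_vector_mult_diff_rdistrib v_def w_def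
          matrix_vector_mul_assoc matrix_mul_assoc)
    moreover have "y \<bullet> (P *v (B *v v)) = v \<bullet> w"
      by (simp add: inner_matrix_vector_left w_def inner_sym_matrix_commute[OF tP, of y])
    ultimately show ?thesis by (simp add: inner_diff_right)
  qed
  have 4: "v \<bullet> (S *v u) = u \<bullet> w"
    using inner_sym_matrix_commute[OF tS, of v u] Sv by simp
  show ?thesis
    by (simp add: v matrix_vector_right_distrib inner_add_left inner_add_right 1 2 3 4 Sv)
qed

text \<open>
  Symmetry is immediate; the form is nonnegative because it is the minimum over \<open>u\<close> of a
  nonnegative quantity.
\<close>
lemma sym_psd_riccati_core:
  fixes P :: "real^'n^'n" and B :: "real^'m^'n"
  assumes P: "sym_psd P" and R: "sym_pd R"
  shows "sym_psd (riccati_core P B R)"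
proof -
  define S where "S = R + transpose B ** P ** B"
  have S: "sym_pd S" using sym_pd_input_weight[OF P R] by (simp add: S_def)
  have tP: "transpose P = P" using P by (simp add: sym_psd_def)
  have "transpose (riccati_core P B R) = riccati_core P B R"
    by (simp add: riccati_core_def S_def[symmetric] transpose_diff matrix_transpose_mul
        sym_pd_matrix_inv(3)[OF S] tP matrix_mul_assoc)
  moreover have "0 \<le> y \<bullet> (riccati_core P B R *v y)" for y
  proof -
    \<comment> \<open>the minimizing \<open>u\<close>, for which the square vanishes\<close>
    define u where "u = - (matrix_inv S ** transpose B ** P *v y)"
    have "0 \<le> (y + B *v u) \<bullet> (P *v (y + B *v u)) + u \<bullet> (R *v u)"
      using P sym_pd_imp_psd[OF R] by (simp add: sym_psd_def)
    then show ?thesis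
      unfolding completing_the_square[OF P R] by (simp add: u_def S_def)
  qed
  ultimately show ?thesis by (simp add: sym_psd_def)
qed

lemma sym_psd_congruence:
  fixes Z :: "real^'n^'n" and G :: "real^'k^'n"
  assumes "sym_psd Z"
  shows "sym_psd (transpose G ** Z ** G)"
  unfolding sym_psd_def
proof (intro conjI allI)
  show "transpose (transpose G ** Z ** G) = transpose G ** Z ** G"
    using assms by (simp add: sym_psd_def matrix_transpose_mul matrix_mul_assoc)
  fix x
  have "0 \<le> (G *v x) \<bullet> (Z *v (G *v x))" using assms by (simp add: sym_psd_def)
  then show "0 \<le> x \<bullet> (transpose G ** Z ** G *v x)"
    by (simp add: inner_matrix_vector_left matrix_vector_mul_assoc matrix_mul_assoc)
qed

lemma sym_psd_add: "sym_psd X \<Longrightarrow> sym_psd Y \<Longrightarrow> sym_psd (X + Y)"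
  by (simp add: sym_psd_def transpose_add matrix_vector_mult_add_rdistrib inner_add_right)

lemma quadratic_congruence_entry:
  "(transpose G ** Z ** G) $ a $ b =
     (\<Sum>c\<in>UNIV. \<Sum>d\<in>UNIV. Z $ c $ d * (G $ c $ a * (G :: real^'k^'n) $ d $ b))"
  unfolding matrix_matrix_mult_def transpose_def
  by (subst sum.swap) (simp add: sum_distrib_left sum_distrib_right mult_ac)

lemma gain_vector:
  fixes A :: "real^'n^'n" and B :: "real^'m^'n"
  shows
  "gain A P B R *v x = - (matrix_inv (R + transpose B ** P ** B) ** transpose B ** P *v (A *v x))"
proof -
  have "(- X) *v x = - (X *v x)" for X :: "real^'n^'m"
    by (simp add: vec_eq_iff matrix_vector_mult_def sum_negf)
  then show ?thesis by (simp add: gain_def matrix_vector_mul_assoc)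
qed

text \<open>
  One step of dynamic programming, for a fixed realization \<open>A\<close> of the system matrix: the cost of
  using \<open>u\<close> in state \<open>x\<close> is a quadratic form in \<open>x\<close> alone plus a term that vanishes exactly for
  the control prescribed by the gain.
\<close>
lemma closed_loop_completing_square:
  fixes P :: "real^'n^'n" and B :: "real^'m^'n"
  assumes P: "sym_psd P" and R: "sym_pd R"
  shows "(A *v x + B *v u) \<bullet> (P *v (A *v x + B *v u)) + u \<bullet> (R *v u) =
    x \<bullet> (riccati A P B R *v x) +
      (u - gain A P B R *v x) \<bullet> ((R + transpose B ** P ** B) *v (u - gain A P B R *v x))"
proof -
  have "u - gain A P B R *v x =
      u + matrix_inv (R + transpose B ** P ** B) ** transpose B ** P *v (A *v x)"
    by (simp add: gain_vector)
  then show ?thesis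
    by (simp only: completing_the_square[OF P R] quadratic_riccati)
qed

section \<open>Block vectors and block rows\<close>

lemma sum_block_vec: "(\<Sum>i\<in>UNIV. block_vec blk i v) = (v :: real^'m)"
  for blk :: "'m::finite \<Rightarrow> 's::finite"
  by (simp add: vec_eq_iff block_vec_def)

lemma sum_block_row: "(\<Sum>i\<in>UNIV. block_row blk i X) = (X :: real^'k^'n)"
  for blk :: "'n::finite \<Rightarrow> 's::finite"
  by (simp add: vec_eq_iff block_row_def)

text \<open>
  The cost of the subsystem inputs adds up to the cost of the stacked input: for zero-padded
  subvectors the cross terms are killed by the block structure of the weight.
\<close>
lemma block_diagonal_quadratic_sum:
  fixes R :: "real^'m^'m" and blk :: "'m::finite \<Rightarrow> 's::finite"
  assumes R: "block_diagonal blk blk R"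
    and u: "\<And>i a. blk a \<noteq> i \<Longrightarrow> u i $ a = 0"
  shows "(\<Sum>i\<in>UNIV. u i \<bullet> (R *v u i)) = (\<Sum>i\<in>UNIV. u i) \<bullet> (R *v (\<Sum>i\<in>UNIV. u i))"
proof -
  have 0: "u i \<bullet> (R *v u j) = 0" if "i \<noteq> j" for i j
    unfolding inner_vec_def matrix_vector_mult_def
  proof (simp, intro sum.neutral ballI)
    fix a
    have "(\<Sum>b\<in>UNIV. R $ a $ b * u j $ b) = 0" if "blk a = i"
      using R u \<open>i \<noteq> j\<close> that by (intro sum.neutral) (metis block_diagonal_def mult_eq_0_iff)
    then show "u i $ a * (\<Sum>b\<in>UNIV. R $ a $ b * u j $ b) = 0"
      using u[of a i] by fastforce
  qed
  have "(\<Sum>i\<in>UNIV. u i) \<bullet> (R *v (\<Sum>i\<in>UNIV. u i)) = (\<Sum>i\<in>UNIV. \<Sum>j\<in>UNIV. u i \<bullet> (R *v u j))"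
    by (simp add: linear_sum[OF matrix_vector_mul_linear] inner_sum_left inner_sum_right)
      (rule sum.swap)
  also have "\<dots> = (\<Sum>i\<in>UNIV. \<Sum>j\<in>UNIV. if i = j then u i \<bullet> (R *v u i) else 0)"
    using 0 by (intro sum.cong) auto
  finally show ?thesis by simp
qed

section \<open>Measurability and integrals of vectors and matrices\<close>

lemma borel_measurable_vecI:
  fixes f :: "'a \<Rightarrow> 'b::euclidean_space^'n"
  assumes "\<And>i. (\<lambda>x. f x $ i) \<in> borel_measurable N"
  shows "f \<in> borel_measurable N"
  using assms by (subst borel_measurable_euclidean_space) (auto simp: Basis_vec_def inner_axis)

lemma borel_measurable_vec_nth [measurable (raw)]:
  fixes f :: "'a \<Rightarrow> 'b::euclidean_space^'n"
  assumes "f \<in> borel_measurable N"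
  shows "(\<lambda>x. f x $ i) \<in> borel_measurable N"
  using assms by (rule borel_measurable_continuous_onI[THEN measurable_compose[rotated], rotated])
    (intro continuous_intros)

lemma borel_measurable_matrix_vector_mult [measurable (raw)]:
  fixes f :: "'a \<Rightarrow> real^'n^'m"
  assumes [measurable]: "f \<in> borel_measurable N" "g \<in> borel_measurable N"
  shows "(\<lambda>x. f x *v g x) \<in> borel_measurable N"
  by (rule borel_measurable_vecI) (simp add: matrix_vector_mult_def)

lemma borel_measurable_block_vec:
  fixes f :: "'a \<Rightarrow> real^'m"
  assumes [measurable]: "f \<in> borel_measurable N"
  shows "(\<lambda>x. block_vec blk i (f x)) \<in> borel_measurable N"
  by (intro borel_measurable_vecI) (simp add: block_vec_def)

lemma integrable_matrixI:
  fixes f :: "'a \<Rightarrow> real^'n^'m"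
  assumes "\<And>i j. integrable N (\<lambda>x. f x $ i $ j)"
  shows "integrable N f"
proof -
  have "integrable N (\<lambda>x. \<Sum>b\<in>Basis. (f x \<bullet> b) *\<^sub>R b)"
    using assms by (intro Bochner_Integration.integrable_sum integrable_scaleR_left)
      (auto simp: Basis_vec_def inner_axis)
  then show ?thesis by (simp add: euclidean_representation)
qed

lemma integral_matrix_nth:
  fixes f :: "'a \<Rightarrow> real^'n^'m"
  assumes "integrable N f"
  shows "integral\<^sup>L N f $ i $ j = (\<integral>x. f x $ i $ j \<partial>N)"
proof -
  have "bounded_linear (\<lambda>X :: real^'n^'m. X $ i $ j)"
    by (intro bounded_linear_compose[OF bounded_linear_vec_nth bounded_linear_vec_nth])
  then show ?thesis
    using integral_bounded_linear[of "\<lambda>X. X $ i $ j" N f] assms by simp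
qed

lemma bounded_linear_quadratic_form:
  "bounded_linear (\<lambda>W :: real^'n^'n. x \<bullet> (W *v x))"
  by (rule linear_conv_bounded_linear[THEN iffD1], rule linearI)
    (simp_all add: matrix_vector_mult_add_rdistrib inner_add_right scaleR_matrix_vector_assoc[symmetric])

lemma sym_psd_integral:
  fixes W :: "'a \<Rightarrow> real^'n^'n"
  assumes W: "integrable N W" and psd: "\<And>\<omega>. sym_psd (W \<omega>)"
  shows "sym_psd (integral\<^sup>L N W)"
  unfolding sym_psd_def
proof (intro conjI allI)
  have "W \<omega> $ i $ j = W \<omega> $ j $ i" for \<omega> i j
    using psd[of \<omega>] by (simp add: sym_psd_def transpose_def vec_eq_iff)
  then show "transpose (integral\<^sup>L N W) = integral\<^sup>L N W"
    by (simp add: transpose_def vec_eq_iff integral_matrix_nth[OF W])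
  fix x
  show "0 \<le> x \<bullet> (integral\<^sup>L N W *v x)"
    using psd by (simp add: integral_bounded_linear[OF bounded_linear_quadratic_form W, symmetric] sym_psd_def)
qed

lemma integrable_congruence:
  fixes G :: "'a \<Rightarrow> real^'k^'n"
  assumes "\<And>a b c d. integrable N (\<lambda>\<omega>. G \<omega> $ a $ b * G \<omega> $ c $ d)"
  shows "integrable N (\<lambda>\<omega>. transpose (G \<omega>) ** Z ** G \<omega>)"
  by (rule integrable_matrixI) (simp add: quadratic_congruence_entry assms)

lemma integral_congruence_nth:
  fixes G :: "'a \<Rightarrow> real^'k^'n"
  assumes "\<And>a b c d. integrable N (\<lambda>\<omega>. G \<omega> $ a $ b * G \<omega> $ c $ d)"
  shows "(\<integral>\<omega>. transpose (G \<omega>) ** Z ** G \<omega> \<partial>N) $ a $ b =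
    (\<Sum>c\<in>UNIV. \<Sum>d\<in>UNIV. Z $ c $ d * (\<integral>\<omega>. G \<omega> $ c $ a * G \<omega> $ d $ b \<partial>N))"
  by (simp add: integral_matrix_nth[OF integrable_congruence[OF assms]] quadratic_congruence_entry assms)

text \<open>
  If entries in different block rows of \<open>G\<close> are uncorrelated, the mean of \<open>G\<^sup>T Z G\<close> splits into
  the value at the mean of \<open>G\<close> and one covariance contribution per block row. Entry by entry,
  the cross covariances between different block rows are zero, and those within the block row
  \<open>i\<close> are what the centred matrix restricted to that block row contributes.
\<close>
lemma (in prob_space) integral_congruence_block_rows:
  fixes G :: "'a \<Rightarrow> real^'k^'n::finite" and blk :: "'n \<Rightarrow> 's::finite"
  assumes G1: "\<And>a b. integrable M (\<lambda>\<omega>. G \<omega> $ a $ b)"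
    and G2: "\<And>a b c d. integrable M (\<lambda>\<omega>. G \<omega> $ a $ b * G \<omega> $ c $ d)"
    and uncorrelated: "\<And>a b c d. blk a \<noteq> blk c \<Longrightarrow>
      (\<integral>\<omega>. G \<omega> $ a $ b * G \<omega> $ c $ d \<partial>M) = (\<integral>\<omega>. G \<omega> $ a $ b \<partial>M) * (\<integral>\<omega>. G \<omega> $ c $ d \<partial>M)"
  defines "m \<equiv> integral\<^sup>L M G"
  shows "(\<integral>\<omega>. transpose (G \<omega>) ** Z ** G \<omega> \<partial>M) =
    transpose m ** Z ** m +
    (\<Sum>i\<in>UNIV. \<integral>\<omega>. transpose (block_row blk i (G \<omega> - m)) ** Z ** block_row blk i (G \<omega> - m) \<partial>M)"
proof -
  have m: "m $ a $ b = (\<integral>\<omega>. G \<omega> $ a $ b \<partial>M)" for a b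
    unfolding m_def by (rule integral_matrix_nth[OF integrable_matrixI[OF G1]])
  have prod: "(G \<omega> $ a $ b - m $ a $ b) * (G \<omega> $ c $ d - m $ c $ d) =
      G \<omega> $ a $ b * G \<omega> $ c $ d - m $ c $ d * G \<omega> $ a $ b - m $ a $ b * G \<omega> $ c $ d
        + m $ a $ b * m $ c $ d" for \<omega> a b c d
    by (simp add: algebra_simps)
  have int: "integrable M (\<lambda>\<omega>. (G \<omega> $ a $ b - m $ a $ b) * (G \<omega> $ c $ d - m $ c $ d))" for a b c d
    unfolding prod by (intro Bochner_Integration.integrable_add Bochner_Integration.integrable_diff
        integrable_mult_right G1 G2 integrable_const)
  have cov: "(\<integral>\<omega>. (G \<omega> $ a $ b - m $ a $ b) * (G \<omega> $ c $ d - m $ c $ d) \<partial>M) =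
      (\<integral>\<omega>. G \<omega> $ a $ b * G \<omega> $ c $ d \<partial>M) - m $ a $ b * m $ c $ d" for a b c d
    unfolding prod using G1 G2 by (simp add: m prob_space)
  define D where "D i \<omega> = block_row blk i (G \<omega> - m)" for i \<omega>
  have D: "D i \<omega> $ a $ b * D i \<omega> $ c $ d =
      (if blk a = i \<and> blk c = i then (G \<omega> $ a $ b - m $ a $ b) * (G \<omega> $ c $ d - m $ c $ d) else 0)"
    for i \<omega> a b c d
    by (simp add: D_def block_row_def)
  have intD: "integrable M (\<lambda>\<omega>. D i \<omega> $ a $ b * D i \<omega> $ c $ d)" for i a b c d
    unfolding D by (cases "blk a = i"; cases "blk c = i") (simp_all add: int)
  have covD: "(\<Sum>i\<in>UNIV. \<integral>\<omega>. D i \<omega> $ a $ b * D i \<omega> $ c $ d \<partial>M) =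
      (\<integral>\<omega>. G \<omega> $ a $ b * G \<omega> $ c $ d \<partial>M) - m $ a $ b * m $ c $ d" for a b c d
  proof -
    have "(\<Sum>i\<in>UNIV. \<integral>\<omega>. D i \<omega> $ a $ b * D i \<omega> $ c $ d \<partial>M) =
        (\<Sum>i\<in>UNIV. if blk a = i then (if blk c = blk a
          then (\<integral>\<omega>. G \<omega> $ a $ b * G \<omega> $ c $ d \<partial>M) - m $ a $ b * m $ c $ d else 0) else 0)"
      unfolding D by (intro sum.cong) (auto simp: cov)
    also have "\<dots> = (if blk c = blk a
          then (\<integral>\<omega>. G \<omega> $ a $ b * G \<omega> $ c $ d \<partial>M) - m $ a $ b * m $ c $ d else 0)"
      by simp
    also have "\<dots> = (\<integral>\<omega>. G \<omega> $ a $ b * G \<omega> $ c $ d \<partial>M) - m $ a $ b * m $ c $ d"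
      using uncorrelated[of a c b d] by (auto simp: m)
    finally show ?thesis .
  qed
  have "(\<integral>\<omega>. transpose (G \<omega>) ** Z ** G \<omega> \<partial>M) $ a $ b =
      (transpose m ** Z ** m + (\<Sum>i\<in>UNIV. \<integral>\<omega>. transpose (D i \<omega>) ** Z ** D i \<omega> \<partial>M)) $ a $ b" for a b
  proof -
    have "(\<Sum>i\<in>UNIV. (\<integral>\<omega>. transpose (D i \<omega>) ** Z ** D i \<omega> \<partial>M) $ a $ b) =
        (\<Sum>i\<in>UNIV. \<Sum>c\<in>UNIV. \<Sum>d\<in>UNIV. Z $ c $ d * (\<integral>\<omega>. D i \<omega> $ c $ a * D i \<omega> $ d $ b \<partial>M))"
      by (simp add: integral_congruence_nth[OF intD])
    also have "\<dots> = (\<Sum>c\<in>UNIV. \<Sum>d\<in>UNIV. \<Sum>i\<in>UNIV. Z $ c $ d * (\<integral>\<omega>. D i \<omega> $ c $ a * D i \<omega> $ d $ b \<partial>M))"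
      by (subst sum.swap) (intro sum.cong refl sum.swap)
    also have "\<dots> = (\<Sum>c\<in>UNIV. \<Sum>d\<in>UNIV.
        Z $ c $ d * ((\<integral>\<omega>. G \<omega> $ c $ a * G \<omega> $ d $ b \<partial>M) - m $ c $ a * m $ d $ b))"
      by (simp add: sum_distrib_left[symmetric] covD)
    finally show ?thesis
      by (simp add: integral_congruence_nth[OF G2] quadratic_congruence_entry sum.distrib[symmetric]
          algebra_simps)
  qed
  then show ?thesis by (simp add: vec_eq_iff D_def)
qed

section \<open>The closed loop as a random process\<close>

text \<open>
  Causality: the state at time \<open>k\<close> depends only on the system matrices before \<open>k\<close>.
\<close>
lemma state_cong:
  assumes "\<And>l. l < k \<Longrightarrow> A l = A' l"
  shows "state A B x0 \<psi> k = state A' B x0 \<psi> k"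
  using assms
proof (induction k rule: less_induct)
  case (less k)
  show ?case
  proof (cases k)
    case (Suc j)
    have eq: "state A B x0 \<psi> l = state A' B x0 \<psi> l" if "l \<le> j" for l
      using that less Suc by simp
    have "(\<lambda>l\<in>{..j}. state A B x0 \<psi> l) = (\<lambda>l\<in>{..j}. state A' B x0 \<psi> l)"
      by (intro restrict_ext) (simp add: eq)
    then show ?thesis using less.prems[of j] eq[of j] Suc by simp
  qed simp
qed

lemma borel_measurable_sub_input_of_state:
  assumes "admissible iblk T \<psi>" "k < T"
    and "F k \<in> borel_measurable N"
    and "\<And>l. l \<le> k \<Longrightarrow> (\<lambda>\<omega>. state (\<lambda>l. F l \<omega>) B x0 \<psi> l) \<in> borel_measurable N"
  shows "(\<lambda>\<omega>. sub_input (\<lambda>l. F l \<omega>) B x0 \<psi> k i) \<in> borel_measurable N"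
proof -
  have "\<psi> k i \<in> borel_measurable (borel \<Otimes>\<^sub>M (\<Pi>\<^sub>M l\<in>{..k}. borel))"
    using assms by (simp add: admissible_def)
  moreover have "(\<lambda>\<omega>. (F k \<omega>, \<lambda>l\<in>{..k}. state (\<lambda>l. F l \<omega>) B x0 \<psi> l)) \<in>
      measurable N (borel \<Otimes>\<^sub>M (\<Pi>\<^sub>M l\<in>{..k}. borel))"
    using assms by (intro measurable_Pair measurable_restrict) auto
  ultimately show ?thesis
    unfolding sub_input_def by (rule measurable_compose[rotated])
qed

text \<open>
  The measurable space \<open>N\<close> is arbitrary, so that the statement applies both to the underlying
  probability space and to a product space of matrix sequences.
\<close>
lemma borel_measurable_state:
  fixes F :: "nat \<Rightarrow> 'a \<Rightarrow> real^'n^'n" and B :: "nat \<Rightarrow> real^'m^'n"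
    and \<psi> :: "('n, 'm, 's::finite) control_law"
  assumes adm: "admissible iblk T \<psi>" and "k \<le> T"
    and "\<And>l. l < k \<Longrightarrow> F l \<in> borel_measurable N"
  shows "(\<lambda>\<omega>. state (\<lambda>l. F l \<omega>) B x0 \<psi> k) \<in> borel_measurable N"
  using assms(2,3)
proof (induction k rule: less_induct)
  case (less k)
  show ?case
  proof (cases k)
    case (Suc j)
    have st: "(\<lambda>\<omega>. state (\<lambda>l. F l \<omega>) B x0 \<psi> l) \<in> borel_measurable N" if "l \<le> j" for l
      using that less Suc by simp
    note [measurable] = st[OF order_refl] less.prems(2)[of j, unfolded Suc, OF lessI]
    have [measurable]: "(\<lambda>\<omega>. sub_input (\<lambda>l. F l \<omega>) B x0 \<psi> j i) \<in> borel_measurable N" for i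
      using less.prems Suc st by (intro borel_measurable_sub_input_of_state[OF adm]) auto
    show ?thesis unfolding Suc state_Suc input_def by measurable
  qed simp
qed

lemma borel_measurable_sub_input:
  fixes F :: "nat \<Rightarrow> 'a \<Rightarrow> real^'n^'n" and B :: "nat \<Rightarrow> real^'m^'n"
    and \<psi> :: "('n, 'm, 's::finite) control_law"
  assumes "admissible iblk T \<psi>" and "k < T" and "\<And>l. l \<le> k \<Longrightarrow> F l \<in> borel_measurable N"
  shows "(\<lambda>\<omega>. sub_input (\<lambda>l. F l \<omega>) B x0 \<psi> k i) \<in> borel_measurable N"
  using assms by (intro borel_measurable_sub_input_of_state[OF assms(1)] borel_measurable_state[OF assms(1)]) auto

section \<open>Consequences of independence\<close>

text \<open>
  For independent variables the integral of a nonnegative function of both may be computed with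
  two independent copies of the sample point.
\<close>
lemma (in prob_space) nn_integral_indep_var:
  assumes ind: "indep_var S X T Y" and f: "f \<in> borel_measurable (S \<Otimes>\<^sub>M T)"
  shows "(\<integral>\<^sup>+\<omega>. f (X \<omega>, Y \<omega>) \<partial>M) = (\<integral>\<^sup>+\<omega>. \<integral>\<^sup>+\<omega>'. f (X \<omega>, Y \<omega>') \<partial>M \<partial>M)"
proof -
  have [measurable]: "X \<in> measurable M S" "Y \<in> measurable M T"
    and distr: "distr M S X \<Otimes>\<^sub>M distr M T Y = distr M (S \<Otimes>\<^sub>M T) (\<lambda>x. (X x, Y x))"
    using ind by (simp_all add: indep_var_distribution_eq)
  note [measurable] = f
  interpret Y: prob_space "distr M T Y" by (rule prob_space_distr) simp
  have "(\<integral>\<^sup>+\<omega>. f (X \<omega>, Y \<omega>) \<partial>M) = (\<integral>\<^sup>+z. f z \<partial>distr M (S \<Otimes>\<^sub>M T) (\<lambda>x. (X x, Y x)))"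
    by (subst nn_integral_distr) auto
  also have "\<dots> = (\<integral>\<^sup>+x. \<integral>\<^sup>+y. f (x, y) \<partial>distr M T Y \<partial>distr M S X)"
    unfolding distr[symmetric] by (subst Y.nn_integral_fst) auto
  also have "\<dots> = (\<integral>\<^sup>+\<omega>. \<integral>\<^sup>+y. f (X \<omega>, y) \<partial>distr M T Y \<partial>M)"
    by (subst nn_integral_distr) (auto intro!: Y.borel_measurable_nn_integral)
  also have "\<dots> = (\<integral>\<^sup>+\<omega>. \<integral>\<^sup>+\<omega>'. f (X \<omega>, Y \<omega>') \<partial>M \<partial>M)"
  proof (intro nn_integral_cong)
    fix \<omega> assume "\<omega> \<in> space M"
    then have "X \<omega> \<in> space S" by (rule measurable_space[rotated]) simp
    then have "(\<lambda>y. f (X \<omega>, y)) \<in> borel_measurable T"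
      by (intro measurable_compose[OF measurable_Pair1' f])
    then show "(\<integral>\<^sup>+y. f (X \<omega>, y) \<partial>distr M T Y) = (\<integral>\<^sup>+\<omega>'. f (X \<omega>, Y \<omega>') \<partial>M)"
      by (subst nn_integral_distr) auto
  qed
  finally show ?thesis .
qed

text \<open>
  The state at time \<open>k\<close> is a function of the block rows before \<open>k\<close>, and \<open>A k\<close> of those at time
  \<open>k\<close>, so the two are independent. The constant \<^const>\<open>prob_space.indep_var\<close> relates variables with
  values in one type, whereas a state is a vector and \<open>A k\<close> a matrix; hence the statement is the
  resulting integration rule, obtained from the two independent families of block rows.
\<close>
lemma (in prob_space) nn_integral_state_matrix:
  fixes A :: "nat \<Rightarrow> 'a \<Rightarrow> real^'n^'n" and B :: "nat \<Rightarrow> real^'m^'n"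
    and sblk :: "'n \<Rightarrow> 's::finite" and \<psi> :: "('n, 'm, 's) control_law"
  assumes ind: "indep_vars (\<lambda>_. borel) (\<lambda>(i, k) \<omega>. block_row sblk i (A k \<omega>)) UNIV"
    and adm: "admissible iblk T \<psi>" and "k \<le> T"
    and h: "h \<in> borel_measurable (borel \<Otimes>\<^sub>M borel)"
  shows "(\<integral>\<^sup>+\<omega>. h (state (\<lambda>l. A l \<omega>) B x0 \<psi> k, A k \<omega>) \<partial>M) =
    (\<integral>\<^sup>+\<omega>. \<integral>\<^sup>+\<omega>'. h (state (\<lambda>l. A l \<omega>) B x0 \<psi> k, A k \<omega>') \<partial>M \<partial>M)"
proof -
  define J where "J = (UNIV :: 's set) \<times> {..<k}"
  define K where "K = (UNIV :: 's set) \<times> {k}"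
  define X where "X = (\<lambda>(i, k) \<omega>. block_row sblk i (A k \<omega>))"
  \<comment> \<open>recovers the matrix at time \<open>l\<close> from its block rows\<close>
  define f where "f Y l = (\<Sum>i\<in>UNIV. Y (i, l))" for Y :: "'s \<times> nat \<Rightarrow> real^'n^'n" and l
  have ind: "indep_var (PiM J (\<lambda>_. borel)) (\<lambda>\<omega>. restrict (\<lambda>i. X i \<omega>) J)
      (PiM K (\<lambda>_. borel)) (\<lambda>\<omega>. restrict (\<lambda>i. X i \<omega>) K)"
    using ind by (intro indep_var_restrict[where I = UNIV]) (auto simp: X_def J_def K_def)
  have "(\<lambda>Y. f Y l) \<in> borel_measurable (PiM J (\<lambda>_. borel))" if "l < k" for l
    unfolding f_def using that by (intro borel_measurable_sum measurable_component_singleton) (auto simp: J_def)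
  then have [measurable]: "(\<lambda>Y. state (f Y) B x0 \<psi> k) \<in> borel_measurable (PiM J (\<lambda>_. borel))"
    by (intro borel_measurable_state[OF adm \<open>k \<le> T\<close>, where F = "\<lambda>l Y. f Y l"])
  have [measurable]: "(\<lambda>Y. f Y k) \<in> borel_measurable (PiM K (\<lambda>_. borel))"
    unfolding f_def by (intro borel_measurable_sum measurable_component_singleton) (auto simp: K_def)
  note [measurable] = h
  have hf: "(\<lambda>(Y, Y'). h (state (f Y) B x0 \<psi> k, f Y' k)) \<in>
      borel_measurable (PiM J (\<lambda>_. borel) \<Otimes>\<^sub>M PiM K (\<lambda>_. borel))"
    by measurable
  have J: "state (f (restrict (\<lambda>i. X i \<omega>) J)) B x0 \<psi> k = state (\<lambda>l. A l \<omega>) B x0 \<psi> k" for \<omega>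
    by (intro state_cong) (simp add: f_def J_def X_def sum_block_row)
  have K: "f (restrict (\<lambda>i. X i \<omega>) K) k = A k \<omega>" for \<omega>
    by (simp add: f_def K_def X_def sum_block_row)
  show ?thesis
    using nn_integral_indep_var[OF ind hf] by (simp add: J K)
qed

lemma (in prob_space) uncorrelated_block_rows:
  fixes A :: "nat \<Rightarrow> 'a \<Rightarrow> real^'n^'n" and sblk :: "'n \<Rightarrow> 's::finite"
  assumes ind: "indep_vars (\<lambda>_. borel) (\<lambda>(i, k) \<omega>. block_row sblk i (A k \<omega>)) UNIV"
    and int: "\<And>a b. integrable M (\<lambda>\<omega>. A k \<omega> $ a $ b)"
    and "sblk a \<noteq> sblk c"
  shows "(\<integral>\<omega>. A k \<omega> $ a $ b * A k \<omega> $ c $ d \<partial>M) =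
    (\<integral>\<omega>. A k \<omega> $ a $ b \<partial>M) * (\<integral>\<omega>. A k \<omega> $ c $ d \<partial>M)"
proof (rule indep_var_lebesgue_integral)
  define X where "X = (\<lambda>(i, k) \<omega>. block_row sblk i (A k \<omega>))"
  have "indep_var (PiM {(sblk a, k)} (\<lambda>_. borel)) (\<lambda>\<omega>. restrict (\<lambda>i. X i \<omega>) {(sblk a, k)})
      (PiM {(sblk c, k)} (\<lambda>_. borel)) (\<lambda>\<omega>. restrict (\<lambda>i. X i \<omega>) {(sblk c, k)})"
    using ind \<open>sblk a \<noteq> sblk c\<close> by (intro indep_var_restrict[where I = UNIV]) (auto simp: X_def)
  then have "indep_var borel ((\<lambda>Y. Y (sblk a, k) $ a $ b) \<circ> (\<lambda>\<omega>. restrict (\<lambda>i. X i \<omega>) {(sblk a, k)}))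
      borel ((\<lambda>Y. Y (sblk c, k) $ c $ d) \<circ> (\<lambda>\<omega>. restrict (\<lambda>i. X i \<omega>) {(sblk c, k)}))"
    by (rule indep_var_compose) (intro borel_measurable_vec_nth measurable_component_singleton; simp)+
  then show "indep_var borel (\<lambda>\<omega>. A k \<omega> $ a $ b) borel (\<lambda>\<omega>. A k \<omega> $ c $ d)"
    by (simp add: comp_def X_def block_row_def)
qed (use int in auto)

text \<open>
  For \<open>X\<close> independent of \<open>G\<close>, in the form of the integration rule, the random matrix \<open>G\<^sup>T Z G\<close>
  may be replaced by its mean under the integral. No moments of \<open>X\<close> are required, since all
  integrands are nonnegative; both sides may be infinite.
\<close>
lemma (in prob_space) nn_integral_quadratic_indep:
  fixes X :: "'a \<Rightarrow> real^'k" and G :: "'a \<Rightarrow> real^'k^'n"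
  assumes tonelli: "\<And>h. h \<in> borel_measurable (borel \<Otimes>\<^sub>M borel) \<Longrightarrow>
      (\<integral>\<^sup>+\<omega>. h (X \<omega>, G \<omega>) \<partial>M) = (\<integral>\<^sup>+\<omega>. \<integral>\<^sup>+\<omega>'. h (X \<omega>, G \<omega>') \<partial>M \<partial>M)"
    and Z: "sym_psd Z"
    and G2: "\<And>a b c d. integrable M (\<lambda>\<omega>. G \<omega> $ a $ b * G \<omega> $ c $ d)"
  shows "(\<integral>\<^sup>+\<omega>. ennreal (X \<omega> \<bullet> (transpose (G \<omega>) ** Z ** G \<omega> *v X \<omega>)) \<partial>M) =
    (\<integral>\<^sup>+\<omega>. ennreal (X \<omega> \<bullet> ((\<integral>\<omega>. transpose (G \<omega>) ** Z ** G \<omega> \<partial>M) *v X \<omega>)) \<partial>M)"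
proof -
  define W where "W = (\<lambda>\<omega>. transpose (G \<omega>) ** Z ** G \<omega>)"
  define q where "q = (\<lambda>(x, Y :: real^'k^'n). ennreal ((Y *v x) \<bullet> (Z *v (Y *v x))))"
  have q: "q (x, G \<omega>) = ennreal (x \<bullet> (W \<omega> *v x))" for x \<omega>
    by (simp add: q_def W_def inner_matrix_vector_left matrix_vector_mul_assoc matrix_mul_assoc)
  have "(\<lambda>p :: (real^'k) \<times> (real^'k^'n). (snd p *v fst p) \<bullet> (Z *v (snd p *v fst p)))
      \<in> borel_measurable (borel \<Otimes>\<^sub>M borel)"
    by (intro borel_measurable_inner borel_measurable_matrix_vector_mult) auto
  then have "q \<in> borel_measurable (borel \<Otimes>\<^sub>M borel)"
    by (simp add: q_def split_beta')
  then have "(\<integral>\<^sup>+\<omega>. q (X \<omega>, G \<omega>) \<partial>M) = (\<integral>\<^sup>+\<omega>. \<integral>\<^sup>+\<omega>'. q (X \<omega>, G \<omega>') \<partial>M \<partial>M)"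
    by (rule tonelli)
  also have "\<dots> = (\<integral>\<^sup>+\<omega>. ennreal (X \<omega> \<bullet> (integral\<^sup>L M W *v X \<omega>)) \<partial>M)"
  proof (intro nn_integral_cong)
    fix \<omega>
    have W: "integrable M W" unfolding W_def by (rule integrable_congruence[OF G2])
    have "0 \<le> X \<omega> \<bullet> (W \<omega>' *v X \<omega>)" for \<omega>'
      using sym_psd_congruence[OF Z, of "G \<omega>'"] by (simp add: W_def sym_psd_def)
    then show "(\<integral>\<^sup>+\<omega>'. q (X \<omega>, G \<omega>') \<partial>M) = ennreal (X \<omega> \<bullet> (integral\<^sup>L M W *v X \<omega>))"
      using integrable_bounded_linear[OF bounded_linear_quadratic_form W]
      by (simp add: q nn_integral_eq_integral integral_bounded_linear[OF bounded_linear_quadratic_form W])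
  qed
  finally show ?thesis by (simp add: q W_def)
qed

section \<open>Cost of an admissible law\<close>

text \<open>
  The amount by which applying \<open>u\<close> in state \<open>x\<close>, when the system matrix is \<open>A\<close>, exceeds the
  minimal sum of the input cost and the quadratic form of \<open>P\<close> at the next state.
\<close>
definition control_excess ::
  "real^'n^'n \<Rightarrow> real^'n^'n \<Rightarrow> real^'m^'n \<Rightarrow> real^'m^'m \<Rightarrow> real^'n \<Rightarrow> real^'m \<Rightarrow> real" where
  "control_excess A P B R x u =
     (u - gain A P B R *v x) \<bullet> ((R + transpose B ** P ** B) *v (u - gain A P B R *v x))"

lemma control_excess_nonneg:
  assumes "sym_psd P" "sym_pd R"
  shows "0 \<le> control_excess A P B R x u"
  using sym_pd_imp_psd[OF sym_pd_input_weight[OF assms, of B]]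
  unfolding control_excess_def sym_psd_def by blast

lemma control_excess_eq_0_iff:
  assumes "sym_psd P" "sym_pd R"
  shows "control_excess A P B R x u = 0 \<longleftrightarrow> u = gain A P B R *v x"
proof
  assume "control_excess A P B R x u = 0"
  then have "u - gain A P B R *v x = 0"
    using sym_pd_input_weight[OF assms, of B] unfolding control_excess_def sym_pd_def
    by (metis less_irrefl)
  then show "u = gain A P B R *v x" by simp
qed (simp add: control_excess_def)

lemma borel_measurable_control_excess:
  fixes P :: "real^'n^'n" and B :: "real^'m^'n"
  assumes [measurable]: "A \<in> borel_measurable N" "x \<in> borel_measurable N" "u \<in> borel_measurable N"
  shows "(\<lambda>\<omega>. control_excess (A \<omega>) P B R (x \<omega>) (u \<omega>)) \<in> borel_measurable N"
  unfolding control_excess_def gain_vector by simp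

lemma sym_psd_riccati: "sym_psd P \<Longrightarrow> sym_pd R \<Longrightarrow> sym_psd (riccati A P B R)"
  unfolding riccati_eq_core by (intro sym_psd_congruence sym_psd_riccati_core)

lemma integrable_riccati:
  fixes G :: "'a \<Rightarrow> real^'n^'n"
  assumes "\<And>a b c d. integrable N (\<lambda>\<omega>. G \<omega> $ a $ b * G \<omega> $ c $ d)"
  shows "integrable N (\<lambda>\<omega>. riccati (G \<omega>) P B R)"
  unfolding riccati_eq_core by (rule integrable_congruence[OF assms])

text \<open>
  By backward induction from \<open>P T = Q T\<close>. The recursion is used in the form
  \<open>P k = Q k + E[A\<^sup>T Z A]\<close>, without separating the mean from the covariances.
\<close>
lemma sym_psd_value_matrix:
  fixes A :: "nat \<Rightarrow> 'a \<Rightarrow> real^'n^'n" and P Q :: "nat \<Rightarrow> real^'n^'n"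
  assumes A2: "\<And>k a b c d. integrable N (\<lambda>\<omega>. A k \<omega> $ a $ b * A k \<omega> $ c $ d)"
    and Q: "\<And>k. k \<le> T \<Longrightarrow> sym_psd (Q k)"
    and R: "\<And>k. k < T \<Longrightarrow> sym_pd (R k)"
    and PT: "P T = Q T"
    and P: "\<And>k. k < T \<Longrightarrow> P k = Q k + (\<integral>\<omega>. riccati (A k \<omega>) (P (Suc k)) (B k) (R k) \<partial>N)"
    and "k \<le> T"
  shows "sym_psd (P k)"
  using \<open>k \<le> T\<close>
proof (induction k rule: inc_induct)
  case base
  then show ?case using Q PT by simp
next
  case (step k)
  then show ?case
    using P[of k] Q[of k] R[of k]
    by (simp add: sym_psd_add sym_psd_integral integrable_riccati[OF A2] sym_psd_riccati)
qed

text \<open>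
  The central identity: for every admissible law, the cost is the value \<open>x0\<^sup>T P 0 x0\<close> plus the
  expected excesses. It holds in the extended nonnegative reals, with no integrability assumption
  on the law. It is proved by induction on \<open>k\<close> for the problem stopped at time \<open>k\<close> with
  terminal weight \<open>P k\<close>.
\<close>
lemma (in prob_space) cost_eq_value_plus_excess:
  fixes A :: "nat \<Rightarrow> 'a \<Rightarrow> real^'n^'n" and B :: "nat \<Rightarrow> real^'m^'n"
    and P Q :: "nat \<Rightarrow> real^'n^'n" and R :: "nat \<Rightarrow> real^'m^'m"
    and sblk :: "'n \<Rightarrow> 's::finite" and iblk :: "'m \<Rightarrow> 's" and \<psi> :: "('n, 'm, 's) control_law"
  assumes A [measurable]: "\<And>k. A k \<in> borel_measurable M"
    and A2: "\<And>k a b c d. integrable M (\<lambda>\<omega>. A k \<omega> $ a $ b * A k \<omega> $ c $ d)"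
    and ind: "indep_vars (\<lambda>_. borel) (\<lambda>(i, k) \<omega>. block_row sblk i (A k \<omega>)) UNIV"
    and Q: "\<And>k. k \<le> T \<Longrightarrow> sym_psd (Q k)"
    and Rblk: "\<And>k. k < T \<Longrightarrow> block_diagonal iblk iblk (R k)"
    and R: "\<And>k. k < T \<Longrightarrow> sym_pd (R k)"
    and PT: "P T = Q T"
    and P: "\<And>k. k < T \<Longrightarrow> P k = Q k + (\<integral>\<omega>. riccati (A k \<omega>) (P (Suc k)) (B k) (R k) \<partial>M)"
    and adm: "admissible iblk T \<psi>"
  shows "cost M A B Q R T x0 \<psi> = ennreal (x0 \<bullet> (P 0 *v x0)) +
    (\<Sum>k<T. \<integral>\<^sup>+\<omega>. ennreal (control_excess (A k \<omega>) (P (Suc k)) (B k) (R k)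
       (state (\<lambda>l. A l \<omega>) B x0 \<psi> k) (input (\<lambda>l. A l \<omega>) B x0 \<psi> k)) \<partial>M)"
proof -
  define X where "X k \<omega> = state (\<lambda>l. A l \<omega>) B x0 \<psi> k" for k \<omega>
  define U where "U k \<omega> = input (\<lambda>l. A l \<omega>) B x0 \<psi> k" for k \<omega>
  define e where "e k \<omega> = control_excess (A k \<omega>) (P (Suc k)) (B k) (R k) (X k \<omega>) (U k \<omega>)" for k \<omega>
  define stage where "stage k \<omega> = X k \<omega> \<bullet> (Q k *v X k \<omega>) + U k \<omega> \<bullet> (R k *v U k \<omega>)" for k \<omega>
  define EW where "EW k = (\<integral>\<omega>. riccati (A k \<omega>) (P (Suc k)) (B k) (R k) \<partial>M)" for k
  have psdP: "sym_psd (P k)" if "k \<le> T" for k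
    by (rule sym_psd_value_matrix[OF A2 Q R PT P that])
  have mX [measurable]: "X k \<in> borel_measurable M" if "k \<le> T" for k
    unfolding X_def by (rule borel_measurable_state[OF adm that A])
  have mU [measurable]: "U k \<in> borel_measurable M" if "k < T" for k
    unfolding U_def input_def by (intro borel_measurable_sum borel_measurable_sub_input[OF adm that A])
  have me: "e k \<in> borel_measurable M" if "k < T" for k
    unfolding e_def using mX[of k] mU[of k] that by (intro borel_measurable_control_excess A) auto
  have mstage: "stage k \<in> borel_measurable M" if "k < T" for k
  proof -
    note [measurable] = mX[OF less_imp_le[OF that]] mU[OF that]
    show ?thesis unfolding stage_def by measurable
  qed
  have stage: "0 \<le> stage k \<omega>" if "k < T" for k \<omega>
    using that Q[of k] sym_pd_imp_psd[OF R[of k]] by (simp add: stage_def sym_psd_def)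
  have e: "0 \<le> e k \<omega>" if "k < T" for k \<omega>
    using that psdP[of "Suc k"] R[of k] by (simp add: e_def control_excess_nonneg)
  have X_Suc: "X (Suc k) \<omega> = A k \<omega> *v X k \<omega> + B k *v U k \<omega>" for k \<omega>
    by (simp add: X_def U_def state_Suc del: state.simps)

  have main: "(\<integral>\<^sup>+\<omega>. ennreal ((\<Sum>l<k. stage l \<omega>) + X k \<omega> \<bullet> (P k *v X k \<omega>)) \<partial>M) =
      ennreal (x0 \<bullet> (P 0 *v x0)) + (\<Sum>l<k. \<integral>\<^sup>+\<omega>. ennreal (e l \<omega>) \<partial>M)" if "k \<le> T" for k
    using that
  proof (induction k)
    case 0
    then show ?case by (simp add: X_def emeasure_space_1)
  next
    case (Suc k)
    then have k: "k < T" "k \<le> T" by auto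
    \<comment> \<open>The integrand for \<open>k + 1\<close> is \<open>h + w + e k\<close>, where the matrix of the form \<open>w\<close> is random;
      with that matrix averaged, \<open>w\<close> becomes \<open>v\<close>, and \<open>h + v\<close> is the integrand for \<open>k\<close>.\<close>
    define h where "h \<omega> = (\<Sum>l<k. stage l \<omega>) + X k \<omega> \<bullet> (Q k *v X k \<omega>)" for \<omega>
    define w where "w \<omega> = X k \<omega> \<bullet> (riccati (A k \<omega>) (P (Suc k)) (B k) (R k) *v X k \<omega>)" for \<omega>
    define v where "v \<omega> = X k \<omega> \<bullet> (EW k *v X k \<omega>)" for \<omega>
    note [measurable] = mX[OF k(2)] me[OF k(1)]
    have [measurable]: "h \<in> borel_measurable M"
      unfolding h_def using k by (intro borel_measurable_add borel_measurable_sum mstage) auto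
    have [measurable]: "w \<in> borel_measurable M"
      unfolding w_def quadratic_riccati by measurable
    have [measurable]: "v \<in> borel_measurable M"
      unfolding v_def by measurable
    have psdZ: "sym_psd (riccati_core (P (Suc k)) (B k) (R k))"
      using psdP[of "Suc k"] R[OF k(1)] Suc.prems by (intro sym_psd_riccati_core)
    have h: "0 \<le> h \<omega>" for \<omega>
      unfolding h_def using k Q[of k] by (intro add_nonneg_nonneg sum_nonneg stage) (auto simp: sym_psd_def)
    have w: "0 \<le> w \<omega>" for \<omega>
      using psdZ by (simp add: w_def quadratic_riccati sym_psd_def)
    have v: "0 \<le> v \<omega>" for \<omega>
    proof -
      have "sym_psd (EW k)"
        unfolding EW_def using psdP[of "Suc k"] R[OF k(1)] Suc.prems
        by (intro sym_psd_integral integrable_riccati A2 sym_psd_riccati)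
      then show ?thesis by (simp add: v_def sym_psd_def)
    qed
    have wv: "(\<integral>\<^sup>+\<omega>. ennreal (w \<omega>) \<partial>M) = (\<integral>\<^sup>+\<omega>. ennreal (v \<omega>) \<partial>M)"
      unfolding w_def v_def EW_def riccati_eq_core X_def
      by (rule nn_integral_quadratic_indep[OF nn_integral_state_matrix[OF ind adm k(2)] psdZ A2])
    have "(\<Sum>l<Suc k. stage l \<omega>) + X (Suc k) \<omega> \<bullet> (P (Suc k) *v X (Suc k) \<omega>) = h \<omega> + w \<omega> + e k \<omega>" for \<omega>
      using closed_loop_completing_square[OF psdP[OF Suc.prems] R[OF k(1)], of "A k \<omega>" "X k \<omega>" "B k" "U k \<omega>"]
      by (simp add: X_Suc h_def w_def e_def control_excess_def stage_def)
    then have "(\<integral>\<^sup>+\<omega>. ennreal ((\<Sum>l<Suc k. stage l \<omega>) + X (Suc k) \<omega> \<bullet> (P (Suc k) *v X (Suc k) \<omega>)) \<partial>M) =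
        (\<integral>\<^sup>+\<omega>. ennreal (h \<omega>) + ennreal (w \<omega>) + ennreal (e k \<omega>) \<partial>M)"
      using h w e[OF k(1)] by simp
    also have "\<dots> = (\<integral>\<^sup>+\<omega>. ennreal (h \<omega>) + ennreal (v \<omega>) \<partial>M) + (\<integral>\<^sup>+\<omega>. ennreal (e k \<omega>) \<partial>M)"
      by (simp add: nn_integral_add wv)
    also have "(\<integral>\<^sup>+\<omega>. ennreal (h \<omega>) + ennreal (v \<omega>) \<partial>M) =
        (\<integral>\<^sup>+\<omega>. ennreal ((\<Sum>l<k. stage l \<omega>) + X k \<omega> \<bullet> (P k *v X k \<omega>)) \<partial>M)"
    proof (intro nn_integral_cong)
      fix \<omega>
      have "h \<omega> + v \<omega> = (\<Sum>l<k. stage l \<omega>) + X k \<omega> \<bullet> (P k *v X k \<omega>)"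
        unfolding P[OF k(1)] h_def v_def EW_def
        by (simp add: matrix_vector_mult_add_rdistrib inner_add_right)
      then show "ennreal (h \<omega>) + ennreal (v \<omega>) =
          ennreal ((\<Sum>l<k. stage l \<omega>) + X k \<omega> \<bullet> (P k *v X k \<omega>))"
        using h v by (simp flip: ennreal_plus)
    qed
    finally show ?case
      using Suc k by (simp add: add.assoc)
  qed
  have "(\<Sum>j\<in>UNIV. sub_input (\<lambda>l. A l \<omega>) B x0 \<psi> k j \<bullet> (R k *v sub_input (\<lambda>l. A l \<omega>) B x0 \<psi> k j)) =
      U k \<omega> \<bullet> (R k *v U k \<omega>)" if "k < T" for k \<omega>
    unfolding U_def input_def using adm that
    by (intro block_diagonal_quadratic_sum[OF Rblk[OF that]]) (auto simp: admissible_def sub_input_def)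
  then have "cost M A B Q R T x0 \<psi> =
      (\<integral>\<^sup>+\<omega>. ennreal ((\<Sum>l<T. stage l \<omega>) + X T \<omega> \<bullet> (P T *v X T \<omega>)) \<partial>M)"
    by (simp add: cost_def Let_def stage_def PT add.commute flip: X_def)
  also note main[OF order_refl]
  finally show ?thesis by (simp add: e_def X_def U_def)
qed

section \<open>Optimality of the Riccati law\<close>

lemma input_riccati_law:
  "input A B x0 (riccati_law iblk P B R) k =
    gain (A k) (P (Suc k)) (B k) (R k) *v state A B x0 (riccati_law iblk P B R) k"
  by (simp add: input_def sub_input_def riccati_law_def sum_block_vec)

lemma admissible_riccati_law:
  fixes B :: "nat \<Rightarrow> real^'m^'n" and iblk :: "'m \<Rightarrow> 's"
  shows "admissible iblk T (riccati_law iblk P B R)"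
  unfolding admissible_def
proof (intro allI impI conjI)
  fix k i
  have [measurable]: "(\<lambda>p :: (real^'n^'n) \<times> (nat \<Rightarrow> real^'n). snd p k) \<in>
      borel_measurable (borel \<Otimes>\<^sub>M (\<Pi>\<^sub>M l\<in>{..k}. borel))"
    by (intro measurable_compose[OF measurable_snd measurable_component_singleton]) auto
  show "riccati_law iblk P B R k i \<in> borel_measurable (borel \<Otimes>\<^sub>M (\<Pi>\<^sub>M l\<in>{..k}. borel))"
    unfolding riccati_law_def split_beta' gain_vector
    by (intro borel_measurable_block_vec) measurable
qed (auto simp: riccati_law_def block_vec_def)

theorem theorem4:
  fixes M :: "'w measure"
    and A :: "nat \<Rightarrow> 'w \<Rightarrow> real^'n^'n"
    and B :: "nat \<Rightarrow> real^'m^'n"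
    and Q P :: "nat \<Rightarrow> real^'n^'n"
    and R :: "nat \<Rightarrow> real^'m^'m"
    and sblk :: "'n::finite \<Rightarrow> 's::finite"
    and iblk :: "'m::finite \<Rightarrow> 's"
    and x0 :: "real^'n"
    and T :: nat
  assumes "prob_space M"
    and "surj sblk" and "surj iblk"
    and "\<And>k. block_diagonal sblk iblk (B k)"
    and "\<And>k. A k \<in> borel_measurable M"
    and "\<And>k a b. integrable M (\<lambda>\<omega>. A k \<omega> $ a $ b)"
    and "\<And>k a b c d. integrable M (\<lambda>\<omega>. A k \<omega> $ a $ b * A k \<omega> $ c $ d)"
    and "prob_space.indep_vars M (\<lambda>_. borel) (\<lambda>(i, k) \<omega>. block_row sblk i (A k \<omega>)) UNIV"
    and "T > 0"
    and "\<And>k. k \<le> T \<Longrightarrow> sym_psd (Q k)"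
    and "\<And>k. k < T \<Longrightarrow> block_diagonal iblk iblk (R k)"
    and "\<And>k. k < T \<Longrightarrow> sym_pd (R k)"
    and "P T = Q T"
    and "\<And>k. k < T \<Longrightarrow>
           P k = Q k + riccati (integral\<^sup>L M (A k)) (P (Suc k)) (B k) (R k) +
             (\<Sum>i\<in>UNIV. integral\<^sup>L M
                (\<lambda>\<omega>. riccati (block_row sblk i (A k \<omega> - integral\<^sup>L M (A k))) (P (Suc k)) (B k) (R k)))"
  shows "is_arg_min (cost M A B Q R T x0) (admissible iblk T) (riccati_law iblk P B R) \<and>
    (\<forall>\<psi>. is_arg_min (cost M A B Q R T x0) (admissible iblk T) \<psi> \<longrightarrow>
       (AE \<omega> in M. \<forall>k<T.
          input (\<lambda>l. A l \<omega>) B x0 \<psi> k =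
          gain (A k \<omega>) (P (Suc k)) (B k) (R k) *v state (\<lambda>l. A l \<omega>) B x0 \<psi> k)) \<and>
    enn2ereal (INF \<psi>\<in>{\<psi>. admissible iblk T \<psi>}. cost M A B Q R T x0 \<psi>) =
      ereal (x0 \<bullet> (P 0 *v x0))"
proof -
  interpret prob_space M by fact
  have A2: "integrable M (\<lambda>\<omega>. A k \<omega> $ a $ b * A k \<omega> $ c $ d)" for k a b c d by fact
  have ind: "indep_vars (\<lambda>_. borel) (\<lambda>(i, k) \<omega>. block_row sblk i (A k \<omega>)) UNIV" by fact
  have Rpd: "sym_pd (R k)" if "k < T" for k using that by fact
  have Qpsd: "sym_psd (Q k)" if "k \<le> T" for k using that by fact
  have Rblk: "block_diagonal iblk iblk (R k)" if "k < T" for k using that by fact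
  \<comment> \<open>the separated mean and covariance terms of the recursion recombine to one expectation\<close>
  have rec: "P k = Q k + (\<integral>\<omega>. riccati (A k \<omega>) (P (Suc k)) (B k) (R k) \<partial>M)" if "k < T" for k
    using assms(14)[OF that] unfolding riccati_eq_core
    by (subst integral_congruence_block_rows[where blk = sblk])
      (auto intro: A2 assms(6) uncorrelated_block_rows[OF ind] simp: add.assoc)
  have psd: "sym_psd (P k)" if "k \<le> T" for k
    by (rule sym_psd_value_matrix[OF A2 Qpsd Rpd \<open>P T = Q T\<close> rec that])
  define e where "e \<psi> k \<omega> = control_excess (A k \<omega>) (P (Suc k)) (B k) (R k)
    (state (\<lambda>l. A l \<omega>) B x0 \<psi> k) (input (\<lambda>l. A l \<omega>) B x0 \<psi> k)"
    for \<psi> :: "('n, 'm, 's) control_law" and k \<omega>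
  define v where "v = x0 \<bullet> (P 0 *v x0)"
  have v: "0 \<le> v" using psd[of 0] by (simp add: v_def sym_psd_def)
  let ?C = "cost M A B Q R T x0"
  let ?opt = "riccati_law iblk P B R"
  have cost: "?C \<psi> = ennreal v + (\<Sum>k<T. \<integral>\<^sup>+\<omega>. ennreal (e \<psi> k \<omega>) \<partial>M)" if "admissible iblk T \<psi>" for \<psi>
    unfolding v_def e_def
    by (rule cost_eq_value_plus_excess[OF assms(5) A2 ind Qpsd Rblk Rpd \<open>P T = Q T\<close> rec that])
  have opt_adm: "admissible iblk T ?opt"
    by (rule admissible_riccati_law)
  have opt: "?C ?opt = ennreal v"
  proof -
    have "e ?opt k \<omega> = 0" for k \<omega>
      by (simp add: e_def control_excess_def input_riccati_law)
    then show ?thesis by (simp add: cost[OF opt_adm])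
  qed
  have le: "?C ?opt \<le> ?C \<psi>" if "admissible iblk T \<psi>" for \<psi>
    by (simp add: opt cost[OF that])
  have arg_min: "is_arg_min ?C (admissible iblk T) ?opt"
    using opt_adm le by (auto simp: is_arg_min_linorder)
  have unique: "AE \<omega> in M. \<forall>k<T. input (\<lambda>l. A l \<omega>) B x0 \<psi> k =
      gain (A k \<omega>) (P (Suc k)) (B k) (R k) *v state (\<lambda>l. A l \<omega>) B x0 \<psi> k"
    if "is_arg_min ?C (admissible iblk T) \<psi>" for \<psi>
  proof -
    have adm: "admissible iblk T \<psi>" and "?C \<psi> \<le> ?C ?opt"
      using that opt_adm by (auto simp: is_arg_min_linorder)
    then have "ennreal v + (\<Sum>k<T. \<integral>\<^sup>+\<omega>. ennreal (e \<psi> k \<omega>) \<partial>M) \<le> ennreal v + 0"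
      by (simp add: cost opt)
    \<comment> \<open>cancelling the value is possible because it is finite\<close>
    then have zero: "(\<Sum>k<T. \<integral>\<^sup>+\<omega>. ennreal (e \<psi> k \<omega>) \<partial>M) = 0"
      by (subst (asm) ennreal_add_left_cancel_le) auto
    have "AE \<omega> in M. input (\<lambda>l. A l \<omega>) B x0 \<psi> k =
        gain (A k \<omega>) (P (Suc k)) (B k) (R k) *v state (\<lambda>l. A l \<omega>) B x0 \<psi> k" if k: "k < T" for k
    proof -
      have "(\<lambda>\<omega>. e \<psi> k \<omega>) \<in> borel_measurable M"
        unfolding e_def input_def using k
        by (intro borel_measurable_control_excess borel_measurable_state[OF adm] borel_measurable_sum
            borel_measurable_sub_input[OF adm] assms(5)) auto
      moreover have "(\<integral>\<^sup>+\<omega>. ennreal (e \<psi> k \<omega>) \<partial>M) = 0"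
        using zero k by simp
      ultimately have "AE \<omega> in M. ennreal (e \<psi> k \<omega>) = 0"
        by (simp add: nn_integral_0_iff_AE)
      then show ?thesis
      proof (rule AE_mp, intro AE_I2 impI)
        fix \<omega> assume "ennreal (e \<psi> k \<omega>) = 0"
        moreover have P: "sym_psd (P (Suc k))" and R: "sym_pd (R k)"
          using k psd Rpd by auto
        ultimately have "e \<psi> k \<omega> = 0"
          using control_excess_nonneg[OF P R] by (simp add: e_def ennreal_eq_0_iff order_antisym)
        then show "input (\<lambda>l. A l \<omega>) B x0 \<psi> k =
            gain (A k \<omega>) (P (Suc k)) (B k) (R k) *v state (\<lambda>l. A l \<omega>) B x0 \<psi> k"
          by (simp add: e_def control_excess_eq_0_iff[OF P R])
      qed
    qed
    then show ?thesis by (simp add: AE_all_countable AE_impI)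
  qed
  have "(INF \<psi>\<in>{\<psi>. admissible iblk T \<psi>}. ?C \<psi>) = ennreal v"
    using le opt_adm by (intro antisym INF_lower2[of ?opt] INF_greatest) (auto simp: opt)
  then have "enn2ereal (INF \<psi>\<in>{\<psi>. admissible iblk T \<psi>}. ?C \<psi>) = ereal (x0 \<bullet> (P 0 *v x0))"
    using v by (simp add: enn2ereal_ennreal v_def)
  with arg_min unique show ?thesis by blast
qed

end
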